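(* Let $G$ be a digraph, and let $\overrightarrow{K_n}$ denote the transitive tournament on $n$ vertices. Then the one-skeleton $(\overrightarrow{\mathrm{Hom}}(G,\overrightarrow{K_n}))^{(1)}$ is either empty or has diameter at most $|V(G)|$.
   Context: A digraph $G$ consists of a finite vertex set $V(G)$ and an edge set $E(G)\subseteq V(G)\times V(G)$ (loops are allowed, and $(v,w)$ and $(w,v)$ may both be edges). $\overrightarrow{K_n}$ is the digraph with vertex set $[n]=\{1,\dots,n\}$ and edges $(i,j)$ for all $i<j$. A multihomomorphism from $G$ to $H$ is a map $\alpha: V(G)\to 2^{V(H)}\setminus\{\emptyset\}$ such that $\alpha(v)\times\alpha(w)\subseteq E(H)$ for every $(v,w)\in E(G)$. $\overrightarrow{\mathrm{Hom}}(G,H)$ is the polyhedral subcomplex of $\prod_{x\in V(G)}\Delta^{V(H)}$ (where $\Delta^{S}$ is the simplex with vertex set $S$) whose cells are the products $\prod_{x}\Delta^{\alpha(x)}$ over all multihomomorphisms $\alpha$. Thus its one-skeleton is the undirected graph whose vertices are the digraph homomorphisms $G\to H$ and whose edges are the multihomomorphisms $\alpha$ with $|\alpha(v)|=2$ for exactly one $v$ and $|\alpha(w)|=1$ for all other $w$ (joining the two homomorphisms obtained by choosing an element of $\alpha(v)$). The diameter is the maximum graph distance between two vertices (in particular, having finite diameter entails being connected). *)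

theory Defs
  imports
    "HOL-Library.FuncSet"
    "Graph_Theory.Pair_Digraph"
    "Graph_Theory.Shortest_Path"
begin

text \<open>
  Finite digraphs, loops allowed, are the pair digraphs satisfying \<open>pair_fin_digraph\<close>.
  Undirected graphs are symmetric digraphs, as in the \<open>Graph_Theory\<close> entry.
\<close>

definition trans_tournament :: "nat \<Rightarrow> nat pair_pre_digraph" where
  "trans_tournament n =
     \<lparr> pverts = {1..n}, parcs = {(i, j). i \<in> {1..n} \<and> j \<in> {1..n} \<and> i < j} \<rparr>"

text \<open>
  Maps out of \<open>V(G)\<close> are extensional, so that equality of maps is equality on \<open>V(G)\<close>.
\<close>

definition dihoms :: "'a pair_pre_digraph \<Rightarrow> 'b pair_pre_digraph \<Rightarrow> ('a \<Rightarrow> 'b) set" where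
  "dihoms G H =
     {f \<in> pverts G \<rightarrow>\<^sub>E pverts H. \<forall>v w. (v, w) \<in> parcs G \<longrightarrow> (f v, f w) \<in> parcs H}"

text \<open>
  A multihomomorphism \<open>\<alpha>\<close> stands for the cell of the Hom complex that is the product over
  \<open>x \<in> V(G)\<close> of the simplices with vertex sets \<open>\<alpha> x\<close>.
\<close>

definition multihoms :: "'a pair_pre_digraph \<Rightarrow> 'b pair_pre_digraph \<Rightarrow> ('a \<Rightarrow> 'b set) set" where
  "multihoms G H =
     {\<alpha> \<in> pverts G \<rightarrow>\<^sub>E (Pow (pverts H) - {{}}).
        \<forall>v w. (v, w) \<in> parcs G \<longrightarrow> \<alpha> v \<times> \<alpha> w \<subseteq> parcs H}"

text \<open>
  \<open>Pi\<^sub>E (pverts G) \<alpha>\<close> is the set of vertices of the cell \<open>\<alpha>\<close>, i.e. of all maps that choose an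
  element of each \<open>\<alpha> x\<close>.  For a one-dimensional cell it has exactly two elements, the
  endpoints of the edge.
\<close>

definition hom_one_skeleton ::
    "'a pair_pre_digraph \<Rightarrow> 'b pair_pre_digraph \<Rightarrow> ('a \<Rightarrow> 'b) pair_pre_digraph" where
  "hom_one_skeleton G H =
     \<lparr> pverts = dihoms G H,
       parcs = {(f, g). \<exists>\<alpha> \<in> multihoms G H. \<exists>v \<in> pverts G.
                  card (\<alpha> v) = 2 \<and> (\<forall>w \<in> pverts G - {v}. card (\<alpha> w) = 1) \<and>
                  Pi\<^sub>E (pverts G) \<alpha> = {f, g}} \<rparr>"

text \<open>
  With unit arc costs, \<open>wf_digraph.\<mu>\<close> is the length of a shortest walk, and \<open>\<infinity>\<close> if there is
  none; hence a finite diameter entails connectedness.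
\<close>

definition graph_dist :: "'a pair_pre_digraph \<Rightarrow> 'a \<Rightarrow> 'a \<Rightarrow> ereal" where
  "graph_dist S u v = wf_digraph.\<mu> (with_proj S) (\<lambda>_. 1) u v"

definition graph_diameter :: "'a pair_pre_digraph \<Rightarrow> ereal" where
  "graph_diameter S = (SUP u \<in> pverts S. SUP v \<in> pverts S. graph_dist S u v)"

lemma PiE_multihom_subset_dihoms:
  assumes G: "pair_wf_digraph G" and \<alpha>: "\<alpha> \<in> multihoms G H"
  shows "Pi\<^sub>E (pverts G) \<alpha> \<subseteq> dihoms G H"
proof
  fix f assume f: "f \<in> Pi\<^sub>E (pverts G) \<alpha>"
  have "f \<in> pverts G \<rightarrow>\<^sub>E pverts H"
    using f \<alpha> by (fastforce simp: multihoms_def PiE_iff)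
  moreover have "(f v, f w) \<in> parcs H" if e: "(v, w) \<in> parcs G" for v w
  proof -
    have "v \<in> pverts G" "w \<in> pverts G"
      using pair_wf_digraph.wellformed'[OF G] e by blast+
    then have "f v \<in> \<alpha> v" "f w \<in> \<alpha> w" using f by auto
    then show ?thesis using \<alpha> e unfolding multihoms_def by blast
  qed
  ultimately show "f \<in> dihoms G H" by (simp add: dihoms_def)
qed

lemma pair_sym_digraph_hom_one_skeleton:
  assumes "pair_wf_digraph G"
  shows "pair_sym_digraph (hom_one_skeleton G H)"
proof
  fix e assume "e \<in> parcs (hom_one_skeleton G H)"
  then obtain \<alpha> where \<alpha>: "\<alpha> \<in> multihoms G H" "Pi\<^sub>E (pverts G) \<alpha> = {fst e, snd e}"
    by (auto simp: hom_one_skeleton_def)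
  from PiE_multihom_subset_dihoms[OF assms \<alpha>(1)]
  show "fst e \<in> pverts (hom_one_skeleton G H)" "snd e \<in> pverts (hom_one_skeleton G H)"
    by (auto simp: hom_one_skeleton_def \<alpha>(2))
next
  show "symmetric (with_proj (hom_one_skeleton G H))"
    by (auto simp: symmetric_def sym_def hom_one_skeleton_def insert_commute)
qed

end

theory Submission
  imports Defs
begin

text \<open>
  Let \<open>f\<close> and \<open>g\<close> be two homomorphisms into the transitive tournament.  Changing one value of
  \<open>f\<close> such that the result is again a homomorphism is moving along an edge of the one-skeleton:
  the arcs out of \<open>v\<close> and those into \<open>v\<close> are respected by both choices of the value at \<open>v\<close>, and a
  loop at \<open>v\<close> cannot occur.  The diameter bound therefore follows if, as long as \<open>f \<noteq> g\<close>, some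
  value of \<open>f\<close> can be replaced by the corresponding value of \<open>g\<close>: each such move lowers
  the number of vertices at which \<open>f\<close> and \<open>g\<close> disagree by one, and initially there are at most
  \<open>card (pverts G)\<close> of them.

  Such a replacement exists because of the linear order on the target (\<open>ex_single_replacement\<close>).
  Suppose \<open>g v < f v\<close> for some \<open>v\<close>, and choose such a \<open>v\<close> with \<open>f v\<close> least.  Lowering the value at
  \<open>v\<close> to \<open>g v\<close> can only harm an arc \<open>(u, v)\<close>.  There \<open>f u < f v\<close>, so \<open>f u \<le> g u\<close> by the choice of
  \<open>v\<close>, and hence \<open>f u \<le> g u < g v\<close>.  If there is no such \<open>v\<close>, the same argument with the order
  reversed raises a value of \<open>f\<close>.
\<close>

lemma dihoms_eqI:
  assumes "f \<in> dihoms G H" "g \<in> dihoms G H" "\<And>v. v \<in> pverts G \<Longrightarrow> f v = g v"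
  shows "f = g"
  by (rule PiE_ext[of _ "pverts G" "\<lambda>_. pverts H"]) (use assms in \<open>simp_all add: dihoms_def\<close>)

lemma dihoms_tournament_iff:
  "f \<in> dihoms G (trans_tournament n) \<longleftrightarrow>
     f \<in> pverts G \<rightarrow>\<^sub>E {1..n} \<and> (\<forall>(u, w) \<in> parcs G. f u \<in> {1..n} \<and> f w \<in> {1..n} \<and> f u < f w)"
  by (auto simp: dihoms_def trans_tournament_def)

lemma fun_upd_dihoms_tournament:
  assumes "f \<in> dihoms G (trans_tournament n)" "v \<in> pverts G" "y \<in> {1..n}"
    and "\<And>u. (u, v) \<in> parcs G \<Longrightarrow> f u < y"
    and "\<And>w. (v, w) \<in> parcs G \<Longrightarrow> y < f w"
  shows "f(v := y) \<in> dihoms G (trans_tournament n)"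
proof -
  have "(v, v) \<notin> parcs G"
    using assms(1) by (auto simp: dihoms_tournament_iff)
  then show ?thesis
    using assms by (auto simp: dihoms_tournament_iff PiE_iff extensional_def)
qed

text \<open>
  The two cases are exchanged by reversing the order on the target.  In each of them the value
  at \<open>v\<close> moves towards the values at its neighbours \<open>u\<close> on one side, and the extremal choice of \<open>v\<close>
  makes \<open>g u\<close> lie between \<open>f u\<close> and \<open>g v\<close>, with \<open>f u = g u\<close> possible.
\<close>

lemma ex_single_replacement:
  assumes G: "pair_fin_digraph G"
    and f: "f \<in> dihoms G (trans_tournament n)" and g: "g \<in> dihoms G (trans_tournament n)"
    and neq: "f \<noteq> g"
  shows "\<exists>v \<in> pverts G. f v \<noteq> g v \<and> f(v := g v) \<in> dihoms G (trans_tournament n)"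
proof -
  interpret pair_fin_digraph G by (fact G)
  have farc: "f u < f w" and garc: "g u < g w" if "(u, w) \<in> parcs G" for u w
    using f g that by (auto simp: dihoms_tournament_iff)
  have gran: "g v \<in> {1..n}" if "v \<in> pverts G" for v
    using g that by (auto simp: dihoms_tournament_iff)
  define A where "A = {v \<in> pverts G. g v < f v}"
  define B where "B = {v \<in> pverts G. f v < g v}"
  have fin: "finite A" "finite B"
    by (simp_all add: A_def B_def)
  have "A \<noteq> {} \<or> B \<noteq> {}"
  proof -
    have "\<exists>v \<in> pverts G. f v \<noteq> g v"
      using dihoms_eqI[OF f g] neq by metis
    then show ?thesis by (auto simp: A_def B_def neq_iff)
  qed
  then show ?thesis
  proof
    assume "A \<noteq> {}"
    then have "Min (f ` A) \<in> f ` A"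
      using fin by (intro Min_in) auto
    then obtain v where "v \<in> A" "f v = Min (f ` A)" by (metis imageE)
    then have v: "v \<in> A" "\<And>u. u \<in> A \<Longrightarrow> f v \<le> f u"
      using fin by simp_all
    have "f(v := g v) \<in> dihoms G (trans_tournament n)"
    proof (rule fun_upd_dihoms_tournament[OF f])
      fix u assume e: "(u, v) \<in> parcs G"
      then have "u \<notin> A" using v(2)[of u] farc[OF e] by auto
      then have "f u \<le> g u" using e wellformed' by (auto simp: A_def)
      then show "f u < g v" using garc[OF e] by simp
    next
      fix w assume "(v, w) \<in> parcs G"
      then show "g v < f w" using farc v(1) by (fastforce simp: A_def)
    qed (use v(1) gran in \<open>auto simp: A_def\<close>)
    then show ?thesis using v(1) by (intro bexI[of _ v]) (auto simp: A_def)
  next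
    assume "B \<noteq> {}"
    then have "Max (f ` B) \<in> f ` B"
      using fin by (intro Max_in) auto
    then obtain v where "v \<in> B" "f v = Max (f ` B)" by (metis imageE)
    then have v: "v \<in> B" "\<And>u. u \<in> B \<Longrightarrow> f u \<le> f v"
      using fin by simp_all
    have "f(v := g v) \<in> dihoms G (trans_tournament n)"
    proof (rule fun_upd_dihoms_tournament[OF f])
      fix w assume e: "(v, w) \<in> parcs G"
      then have "w \<notin> B" using v(2)[of w] farc[OF e] by auto
      then have "g w \<le> f w" using e wellformed' by (auto simp: B_def)
      then show "g v < f w" using garc[OF e] by simp
    next
      fix u assume "(u, v) \<in> parcs G"
      then show "f u < g v" using farc v(1) by (fastforce simp: B_def)
    qed (use v(1) gran in \<open>auto simp: B_def\<close>)
    then show ?thesis using v(1) by (intro bexI[of _ v]) (auto simp: B_def)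
  qed
qed

text \<open>
  A cell must satisfy \<open>\<alpha> v \<times> \<alpha> v \<subseteq> parcs H\<close> if there is a loop at \<open>v\<close>, which does not follow from
  its two endpoints being homomorphisms; hence the assumption on \<open>(v, v)\<close>.
\<close>

lemma fun_upd_arc_hom_one_skeleton:
  assumes G: "pair_wf_digraph G" and loop: "(v, v) \<notin> parcs G" and v: "v \<in> pverts G"
    and f: "f \<in> dihoms G H" and f': "f(v := y) \<in> dihoms G H" and neq: "f v \<noteq> y"
  shows "(f, f(v := y)) \<in> parcs (hom_one_skeleton G H)"
proof -
  define \<alpha> where "\<alpha> = (\<lambda>w \<in> pverts G. if w = v then {f v, y} else {f w})"
  have arcs: "\<alpha> x \<times> \<alpha> w \<subseteq> parcs H" if e: "(x, w) \<in> parcs G" for x w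
  proof -
    have "x \<in> pverts G" "w \<in> pverts G"
      using pair_wf_digraph.wellformed'[OF G] e by blast+
    moreover have "(f x, f w) \<in> parcs H" "((f(v := y)) x, (f(v := y)) w) \<in> parcs H"
      using f f' e unfolding dihoms_def by blast+
    ultimately show ?thesis
      using loop e by (auto simp: \<alpha>_def split: if_splits)
  qed
  have "y \<in> pverts H"
    using f' v by (auto simp: dihoms_def PiE_iff dest!: bspec[of _ _ v])
  then have "\<alpha> \<in> pverts G \<rightarrow>\<^sub>E (Pow (pverts H) - {{}})"
    using f v by (auto simp: \<alpha>_def dihoms_def PiE_iff)
  with arcs have \<alpha>: "\<alpha> \<in> multihoms G H"
    by (simp add: multihoms_def)
  have cell: "Pi\<^sub>E (pverts G) \<alpha> = {f, f(v := y)}"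
  proof (intro equalityI subsetI)
    fix h assume h: "h \<in> Pi\<^sub>E (pverts G) \<alpha>"
    have hv: "h v \<in> {f v, y}" and hw: "\<And>w. w \<in> pverts G \<Longrightarrow> w \<noteq> v \<Longrightarrow> h w = f w"
      using h v by (fastforce simp: \<alpha>_def PiE_iff)+
    have off_G: "h w = undefined" "f w = undefined" if "w \<notin> pverts G" for w
      using h f that by (auto simp: dihoms_def PiE_iff extensional_def)
    have off_v: "h w = f w" if "w \<noteq> v" for w
      using hw off_G that by (cases "w \<in> pverts G") auto
    have "h = f" if "h v = f v"
      using that off_v by (intro ext) metis
    moreover have "h = f(v := y)" if "h v = y"
      using that off_v by (intro ext) simp
    ultimately show "h \<in> {f, f(v := y)}" using hv by auto
  next
    fix h assume "h \<in> {f, f(v := y)}"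
    then show "h \<in> Pi\<^sub>E (pverts G) \<alpha>"
      using f f' v by (auto simp: \<alpha>_def dihoms_def PiE_iff)
  qed
  have "card (\<alpha> v) = 2" "\<forall>w \<in> pverts G - {v}. card (\<alpha> w) = 1"
    using neq v by (auto simp: \<alpha>_def)
  with \<alpha> v cell show ?thesis
    by (auto simp: hom_one_skeleton_def)
qed

text \<open>
  The walk changes each value of \<open>f\<close> at which \<open>f\<close> and \<open>g\<close> disagree exactly once, directly to the
  value of \<open>g\<close>, in the order supplied by \<open>ex_single_replacement\<close>.
\<close>

lemma ex_awalk_length_disagreement:
  assumes G: "pair_fin_digraph G"
    and f: "f \<in> dihoms G (trans_tournament n)" and g: "g \<in> dihoms G (trans_tournament n)"
  shows "\<exists>p. pre_digraph.awalk (with_proj (hom_one_skeleton G (trans_tournament n))) f p g \<and>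
             length p = card {v \<in> pverts G. f v \<noteq> g v}"
proof -
  interpret G: pair_fin_digraph G by (fact G)
  interpret S: pair_sym_digraph "hom_one_skeleton G (trans_tournament n)"
    by (intro pair_sym_digraph_hom_one_skeleton) unfold_locales
  show ?thesis
    using f
  proof (induction "card {v \<in> pverts G. f v \<noteq> g v}" arbitrary: f)
    case 0
    then have "\<forall>v \<in> pverts G. f v = g v" by auto
    then have "f = g"
      using dihoms_eqI[OF 0(2) g] by simp
    then have "S.awalk f [] g"
      unfolding S.awalk_Nil_iff using g by (simp add: hom_one_skeleton_def)
    then show ?case using 0(1) by auto
  next
    case (Suc k)
    from Suc(2) have "f \<noteq> g" by auto
    then obtain v where v: "v \<in> pverts G" "f v \<noteq> g v"
      and h: "f(v := g v) \<in> dihoms G (trans_tournament n)"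
      using ex_single_replacement[OF G Suc.prems g] by blast
    define h where "h = f(v := g v)"
    have "{w \<in> pverts G. h w \<noteq> g w} = {w \<in> pverts G. f w \<noteq> g w} - {v}"
      by (auto simp: h_def)
    then have "k = card {w \<in> pverts G. h w \<noteq> g w}"
      using Suc(2) v by simp
    then obtain p where p: "S.awalk h p g" "length p = k"
      using Suc(1)[of h] h by (auto simp: h_def)
    have "(v, v) \<notin> parcs G"
      using Suc.prems by (auto simp: dihoms_tournament_iff)
    then have "(f, h) \<in> parcs (hom_one_skeleton G (trans_tournament n))"
      unfolding h_def
      using fun_upd_arc_hom_one_skeleton[OF _ _ v(1) Suc.prems h v(2)]
        G.pair_wf_digraph_axioms by blast
    then have "S.awalk f ((f, h) # p) g"
      using p(1) by (simp add: S.awalk_Cons_iff)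
    then show ?case
      using p(2) Suc(2) by (metis length_Cons)
  qed
qed

theorem theorem5p4:
  fixes G :: "'a pair_pre_digraph" and n :: nat
  assumes "pair_fin_digraph G"
  shows "pverts (hom_one_skeleton G (trans_tournament n)) = {} \<or>
         graph_diameter (hom_one_skeleton G (trans_tournament n)) \<le> ereal (real (card (pverts G)))"
proof -
  interpret G: pair_fin_digraph G by (fact assms)
  let ?S = "hom_one_skeleton G (trans_tournament n)"
  interpret S: pair_sym_digraph ?S
    by (intro pair_sym_digraph_hom_one_skeleton) unfold_locales
  have "graph_dist ?S f g \<le> ereal (real (card (pverts G)))"
    if fg: "f \<in> pverts ?S" "g \<in> pverts ?S" for f g
  proof -
    obtain p where p: "S.awalk f p g" "length p = card {v \<in> pverts G. f v \<noteq> g v}"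
      using ex_awalk_length_disagreement[OF assms, of f n g] fg
      by (auto simp: hom_one_skeleton_def)
    have "graph_dist ?S f g \<le> ereal (S.awalk_cost (\<lambda>_. 1) p)"
      unfolding graph_dist_def by (rule S.min_cost_le_walk_cost[OF p(1)])
    also have "S.awalk_cost (\<lambda>_. 1) p = real (length p)"
      by (simp add: S.awalk_cost_def sum_list_triv)
    also have "length p \<le> card (pverts G)"
      unfolding p(2) by (intro card_mono) auto
    finally show ?thesis by simp
  qed
  then show ?thesis
    unfolding graph_diameter_def by (auto intro!: SUP_least)
qed

end
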